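(* Let $S(z,\mathbf t)$, $\mathbf t=(t_1,t_2,t_3,\dots)$, be a solution of the dispersionless KP hierarchy, so that, with $p(z)=\partial S(z,\mathbf t)/\partial t_1$, $$p(z)-p(z_1)+z_1\exp(-D(z_1)S(z))=0,\qquad z\in\mathbb C,\ |z_1|>1,$$ for all $\mathbf t$. Suppose that, when all even times $t_2,t_4,\dots$ are set equal to zero, $S$ satisfies the symmetry condition $S(-z,\mathbf t)=-S(z,\mathbf t)$. Then, at zero even times (that is, for the dispersionless BKP hierarchy), $$\frac{p(z_1)-p(z)}{p(z_1)+p(z)}=\exp(-\mathcal D(z_1)S(z)),\qquad z\in\mathbb C,\ |z_1|>1,$$ wherever the denominator is nonzero.
   Context: $S=S_0+\widetilde S$ with $S_0(z,\mathbf t)=\sum_{n\ge1}t_nz^n$, where $\widetilde S(z,\mathbf t)$ is, as a function of $z$, analytic outside the closed unit disc with expansion $\widetilde S=\sum_{i\ge1}\widetilde S_i(\mathbf t)z^{-i}$ at infinity (inside the unit disc $S$ need not be analytic in $z$). $S$ depends smoothly on $\mathbf t$. The quasiclassical vertex operators are, for $|z|>1$, $$D(z)=\sum_{n=1}^\infty\frac{1}{n z^n}\frac{\partial}{\partial t_n},\qquad \mathcal D(z)=2\sum_{n=0}^\infty\frac{z^{-(2n+1)}}{2n+1}\frac{\partial}{\partial t_{2n+1}},$$ acting on the $\mathbf t$-dependence; all series obtained by applying them to $\widetilde S$ are assumed to converge. Since $D(z_1)S_0(z)=-\ln(1-z/z_1)$ and $\mathcal D(z_1)S_0(z)=\ln\frac{z_1+z}{z_1-z}$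 for $|z|<|z_1|$, the exponentials are understood for all $z$ by analytic continuation of the $S_0$-part: $$\exp(-D(z_1)S(z))=\Bigl(1-\frac{z}{z_1}\Bigr)e^{-D(z_1)\widetilde S(z)},\qquad \exp(-\mathcal D(z_1)S(z))=\frac{z_1-z}{z_1+z}\,e^{-\mathcal D(z_1)\widetilde S(z)}.$$ *)

theory Defs
  imports "HOL-Analysis.Analysis"
begin

text \<open>
  The times are sequences \<open>t :: nat \<Rightarrow> complex\<close>; only \<open>t n\<close> with \<open>n \<ge> 1\<close> are times, and the
  dummy entry \<open>t 0\<close> is fixed to be \<open>0\<close>. The set \<open>K\<close> is the field in which the times take values:
  it is \<open>\<real>\<close> or \<open>UNIV\<close>, and all derivatives in the times are taken within \<open>K\<close>, so that they are
  ordinary real, respectively complex, partial derivatives.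
\<close>

definition time_slice :: "complex set \<Rightarrow> nat set \<Rightarrow> (nat \<Rightarrow> complex) \<Rightarrow> (nat \<Rightarrow> complex) set" where
  "time_slice K I t = {s. (\<forall>n\<in>I. s n \<in> K) \<and> (\<forall>n. n \<notin> I \<longrightarrow> s n = t n)}"

text \<open>
  The set \<open>T\<close> of all times under consideration. For \<open>t\<close> in \<open>T\<close> the function \<open>S\<^sub>0(z,t)\<close> is defined for
  every \<open>z\<close>, and \<open>T\<close> is open in every direction of finitely many times. Examples are the
  set of all \<open>K\<close>-valued sequences for which \<open>S\<^sub>0\<close> is entire in \<open>z\<close>, and the set of all finitely
  supported ones (both with \<open>t 0 = 0\<close>). The topology on sequences is the product topology, which on a slice
  along finitely many times is the usual finite-dimensional one.
\<close>

definition time_domain :: "complex set \<Rightarrow> (nat \<Rightarrow> complex) set \<Rightarrow> bool" where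
  "time_domain K T \<longleftrightarrow>
     (\<forall>t\<in>T. t 0 = 0 \<and> (\<forall>n. t n \<in> K) \<and> (\<forall>z::complex. summable (\<lambda>n. t n * z ^ n))) \<and>
     (\<forall>t\<in>T. \<forall>I. finite I \<and> I \<subseteq> {1..} \<longrightarrow>
        openin (top_of_set (time_slice K I t)) (T \<inter> time_slice K I t))"

definition time_deriv ::
  "complex set \<Rightarrow> nat \<Rightarrow> ((nat \<Rightarrow> complex) \<Rightarrow> complex) \<Rightarrow> (nat \<Rightarrow> complex) \<Rightarrow> complex" where
  "time_deriv K n f t =
     (SOME d. ((\<lambda>x. f (t(n := x))) has_field_derivative d) (at (t n) within K))"

text \<open>
  Smooth dependence on infinitely many times: all iterated partial derivatives exist on \<open>T\<close> and are
  jointly continuous in any finitely many times.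
\<close>

definition smooth_in_times ::
  "complex set \<Rightarrow> (nat \<Rightarrow> complex) set \<Rightarrow> ((nat \<Rightarrow> complex) \<Rightarrow> complex) \<Rightarrow> bool" where
  "smooth_in_times K T f \<longleftrightarrow>
     (\<forall>ns. set ns \<subseteq> {1..} \<longrightarrow>
        (\<forall>t\<in>T. \<forall>n\<ge>1. (\<lambda>x. fold (time_deriv K) ns f (t(n := x)))
           field_differentiable (at (t n) within K)) \<and>
        (\<forall>t\<in>T. \<forall>I. finite I \<and> I \<subseteq> {1..} \<longrightarrow>
           continuous_on (T \<inter> time_slice K I t) (fold (time_deriv K) ns f)))"

definition S_zero :: "complex \<Rightarrow> (nat \<Rightarrow> complex) \<Rightarrow> complex" where
  "S_zero z t = (\<Sum>n. t (Suc n) * z ^ Suc n)"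

text \<open>
  Below, \<open>St\<close> is the function \<open>S\<close> with \<open>S\<^sub>0\<close> removed (written with a tilde in the literature),
  so that \<open>S_fun St\<close> is \<open>S\<close>.
\<close>

definition S_fun ::
  "(complex \<Rightarrow> (nat \<Rightarrow> complex) \<Rightarrow> complex) \<Rightarrow> complex \<Rightarrow> (nat \<Rightarrow> complex) \<Rightarrow> complex" where
  "S_fun St z t = S_zero z t + St z t"

definition p_fun ::
  "complex set \<Rightarrow> (complex \<Rightarrow> (nat \<Rightarrow> complex) \<Rightarrow> complex) \<Rightarrow> complex \<Rightarrow> (nat \<Rightarrow> complex) \<Rightarrow> complex"
  where
  "p_fun K St z t = time_deriv K 1 (S_fun St z) t"

definition KP_vertex ::
  "complex set \<Rightarrow> complex \<Rightarrow> ((nat \<Rightarrow> complex) \<Rightarrow> complex) \<Rightarrow> (nat \<Rightarrow> complex) \<Rightarrow> complex" where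
  "KP_vertex K z f t =
     (\<Sum>n. 1 / (of_nat (Suc n) * z ^ Suc n) * time_deriv K (Suc n) f t)"

definition BKP_vertex ::
  "complex set \<Rightarrow> complex \<Rightarrow> ((nat \<Rightarrow> complex) \<Rightarrow> complex) \<Rightarrow> (nat \<Rightarrow> complex) \<Rightarrow> complex" where
  "BKP_vertex K z f t =
     2 * (\<Sum>n. 1 / (of_nat (2 * n + 1) * z ^ (2 * n + 1)) * time_deriv K (2 * n + 1) f t)"

definition vertex_series_converge ::
  "complex set \<Rightarrow> (nat \<Rightarrow> complex) set \<Rightarrow> ((nat \<Rightarrow> complex) \<Rightarrow> complex) \<Rightarrow> bool" where
  "vertex_series_converge K T f \<longleftrightarrow>
     (\<forall>t\<in>T. \<forall>z. norm z > 1 \<longrightarrow>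
        summable (\<lambda>n. 1 / (of_nat (Suc n) * z ^ Suc n) * time_deriv K (Suc n) f t) \<and>
        summable (\<lambda>n. 1 / (of_nat (2 * n + 1) * z ^ (2 * n + 1)) * time_deriv K (2 * n + 1) f t))"

text \<open>
  The exponentials of minus the vertex operators applied to \<open>S\<close>, with the contribution of \<open>S\<^sub>0\<close>
  (a logarithm, given by a convergent series only for \<open>|z| < |z\<^sub>1|\<close>) continued analytically to all \<open>z\<close>.
  The second one has a pole at \<open>z = - z\<^sub>1\<close>, where its value here is meaningless.
\<close>

definition exp_neg_KP_vertex ::
  "complex set \<Rightarrow> (complex \<Rightarrow> (nat \<Rightarrow> complex) \<Rightarrow> complex) \<Rightarrow>
   complex \<Rightarrow> complex \<Rightarrow> (nat \<Rightarrow> complex) \<Rightarrow> complex" where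
  "exp_neg_KP_vertex K St z1 z t = (1 - z / z1) * exp (- KP_vertex K z1 (St z) t)"

definition exp_neg_BKP_vertex ::
  "complex set \<Rightarrow> (complex \<Rightarrow> (nat \<Rightarrow> complex) \<Rightarrow> complex) \<Rightarrow>
   complex \<Rightarrow> complex \<Rightarrow> (nat \<Rightarrow> complex) \<Rightarrow> complex" where
  "exp_neg_BKP_vertex K St z1 z t = (z1 - z) / (z1 + z) * exp (- BKP_vertex K z1 (St z) t)"

text \<open>Nothing about the dependence on \<open>z\<close> is required inside the closed unit disc.\<close>

definition admissible_St ::
  "complex set \<Rightarrow> (nat \<Rightarrow> complex) set \<Rightarrow>
   (complex \<Rightarrow> (nat \<Rightarrow> complex) \<Rightarrow> complex) \<Rightarrow> bool" where
  "admissible_St K T St \<longleftrightarrow>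
     (\<forall>t\<in>T. (\<lambda>z. St z t) analytic_on {z. norm z > 1} \<and>
        (\<exists>c. \<forall>z. norm z > 1 \<longrightarrow> (\<lambda>i. c (Suc i) / z ^ Suc i) sums St z t)) \<and>
     (\<forall>z. smooth_in_times K T (S_fun St z)) \<and>
     (\<forall>z. vertex_series_converge K T (St z))"

definition dKP_solution ::
  "complex set \<Rightarrow> (nat \<Rightarrow> complex) set \<Rightarrow>
   (complex \<Rightarrow> (nat \<Rightarrow> complex) \<Rightarrow> complex) \<Rightarrow> bool" where
  "dKP_solution K T St \<longleftrightarrow>
     admissible_St K T St \<and>
     (\<forall>t\<in>T. \<forall>z z1. norm z1 > 1 \<longrightarrow>
        p_fun K St z t - p_fun K St z1 t + z1 * exp_neg_KP_vertex K St z1 z t = 0)"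

definition zero_even_times :: "(nat \<Rightarrow> complex) set" where
  "zero_even_times = {t. \<forall>n. even n \<longrightarrow> t n = 0}"

end

theory Submission
  imports Defs
begin

text \<open>
  The equation at \<open>z\<^sub>1\<close> expresses \<open>p(z\<^sub>1) - p(z)\<close>, and the equation at \<open>-z\<^sub>1\<close> expresses
  \<open>p(z\<^sub>1) + p(z)\<close>, since \<open>p\<close> is odd at zero even times. In the quotient the even derivatives cancel:
  \<open>D(z\<^sub>1) - D(-z\<^sub>1)\<close> is the BKP vertex operator.
\<close>

lemma has_field_derivative_unique_within:
  assumes "(f has_field_derivative d) (at x within K)" "(f has_field_derivative e) (at x within K)"
    and "at x within K \<noteq> bot"
  shows "d = e"
  using assms tendsto_unique unfolding has_field_derivative_iff by blast

text \<open>\<open>time_deriv\<close> picks some derivative by \<open>SOME\<close>; at a limit point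
  of \<open>K\<close> there is at most one, so any derivative found is the one picked.\<close>

lemma time_deriv_eqI:
  assumes "((\<lambda>x. f (t(n := x))) has_field_derivative d) (at (t n) within K)"
    and "at (t n) within K \<noteq> bot"
  shows "time_deriv K n f t = d"
  unfolding time_deriv_def
  using assms has_field_derivative_unique_within by (intro some_equality) blast+

lemma time_deriv_has_derivative:
  assumes "(\<lambda>x. f (t(n := x))) field_differentiable at (t n) within K"
  shows "((\<lambda>x. f (t(n := x))) has_field_derivative time_deriv K n f t) (at (t n) within K)"
  using assms unfolding time_deriv_def field_differentiable_def by (rule someI_ex)

lemma at_within_field_neq_bot:
  assumes "K = \<real> \<or> K = UNIV" "(x::complex) \<in> K"
  shows "at x within K \<noteq> bot"
proof -
  have "x islimpt \<real>" if "x \<in> \<real>"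
    unfolding islimpt_approachable
  proof (intro allI impI)
    fix e :: real assume "e > 0"
    with that show "\<exists>y\<in>\<real>. y \<noteq> x \<and> dist y x < e"
      by (intro bexI[of _ "x + of_real (e / 2)"]) (auto simp: dist_norm simp flip: of_real_divide)
  qed
  with assms show ?thesis
    by (auto simp: trivial_limit_within)
qed

text \<open>This lets identities known only on \<open>T\<close> be differentiated in a single time.
  Changing one coordinate is a continuous map from \<open>K\<close> into the slice along that
  coordinate, where \<open>T\<close> is relatively open.\<close>

lemma eventually_time_in_domain:
  assumes "time_domain K T" "t \<in> T" "n \<ge> 1"
  shows "\<forall>\<^sub>F x in at (t n) within K. t(n := x) \<in> T"
proof -
  have tK: "t n \<in> K" and op: "openin (top_of_set (time_slice K {n} t)) (T \<inter> time_slice K {n} t)"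
    using assms unfolding time_domain_def by auto
  have "continuous_on K (\<lambda>x. t(n := x))"
  proof (rule continuous_on_coordinatewise_then_product)
    show "continuous_on K (\<lambda>x. (t(n := x)) i)" for i
      by (cases "i = n") auto
  qed
  moreover have slice: "(\<lambda>x. t(n := x)) \<in> K \<rightarrow> time_slice K {n} t"
    by (auto simp: time_slice_def)
  ultimately have "openin (top_of_set K) (K \<inter> (\<lambda>x. t(n := x)) -` (T \<inter> time_slice K {n} t))"
    using continuous_openin_preimage op by blast
  then obtain U where "open U" and U: "K \<inter> (\<lambda>x. t(n := x)) -` (T \<inter> time_slice K {n} t) = K \<inter> U"
    by (auto simp: openin_open)
  moreover have "t n \<in> U"
    using U tK \<open>t \<in> T\<close> slice by (auto simp: time_slice_def)
  ultimately show ?thesis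
    unfolding eventually_at_topological by (intro exI[of _ U]) blast
qed

lemma p_fun_odd:
  assumes K: "K = \<real> \<or> K = UNIV" and T: "time_domain K T"
    and smooth: "smooth_in_times K T (S_fun St z)"
    and odd: "\<forall>t \<in> T \<inter> zero_even_times. \<forall>z. S_fun St (- z) t = - S_fun St z t"
    and t: "t \<in> T \<inter> zero_even_times"
  shows "p_fun K St (- z) t = - p_fun K St z t"
proof -
  have "t 1 \<in> K"
    using T t unfolding time_domain_def by blast
  have "(\<lambda>x. S_fun St z (t(1 := x))) field_differentiable at (t 1) within K"
    \<comment> \<open>For the empty list of derivatives \<open>fold\<close> returns
      \<open>S_fun St z\<close> itself.\<close>
    using smooth t unfolding smooth_in_times_def by (auto dest!: spec[of _ "[]"])
  from DERIV_minus[OF time_deriv_has_derivative[OF this]]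
  have "((\<lambda>x. - S_fun St z (t(1 := x))) has_field_derivative - p_fun K St z t) (at (t 1) within K)"
    unfolding p_fun_def .
  \<comment> \<open>The first time is odd, so moving it keeps the even times zero and the symmetry
    of S persists near \<open>t 1\<close>. The point \<open>t 1\<close> itself, left out by the
    filter, is covered by the symmetry at \<open>t\<close>.\<close>
  moreover have "\<forall>\<^sub>F x in at (t 1) within K. S_fun St (- z) (t(1 := x)) = - S_fun St z (t(1 := x))"
    using eventually_time_in_domain[OF T, of t 1] t
    by (auto elim!: eventually_mono intro!: odd[rule_format] simp: zero_even_times_def)
  ultimately have "((\<lambda>x. S_fun St (- z) (t(1 := x))) has_field_derivative - p_fun K St z t)
      (at (t 1) within K)"
    using odd t by (subst has_field_derivative_cong_eventually) auto
  then show ?thesis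
    unfolding p_fun_def[of K St "- z"]
    by (rule time_deriv_eqI) (rule at_within_field_neq_bot[OF K \<open>t 1 \<in> K\<close>])
qed

lemma KP_vertex_diff_eq_BKP_vertex:
  assumes "vertex_series_converge K T f" "t \<in> T" "norm z > 1"
  shows "KP_vertex K z f t - KP_vertex K (- z) f t = BKP_vertex K z f t"
proof -
  define a where "a w n = 1 / (of_nat (Suc n) * w ^ Suc n) * time_deriv K (Suc n) f t" for w n
  have summ: "summable (a w)" if "norm w > 1" for w
    using assms that unfolding vertex_series_converge_def a_def by blast
  \<comment> \<open>Index \<open>n\<close> of \<open>a\<close> belongs to the time numbered
    \<open>Suc n\<close>, so even indices carry the odd times. Their powers of \<open>z\<close> are
    odd, and the terms double.\<close>
  have even: "a z (2 * n) - a (- z) (2 * n) = 2 * a z (2 * n)" for n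
    by (simp add: a_def)
  have odd: "a z n - a (- z) n = 0" if "n \<notin> range (\<lambda>n. 2 * n)" for n
  proof -
    from that have "odd n" by (auto elim!: evenE)
    then show ?thesis by (simp add: a_def)
  qed
  have "(\<lambda>n. a z n - a (- z) n) sums (suminf (a z) - suminf (a (- z)))"
    using assms(3) by (intro sums_diff summable_sums summ) auto
  \<comment> \<open>The difference series vanishes off the even indices, so reindexing by
    \<open>2 * n\<close> keeps its sum.\<close>
  then have "(\<lambda>n. 2 * a z (2 * n)) sums (suminf (a z) - suminf (a (- z)))"
    using sums_mono_reindex[of "\<lambda>n. 2 * n" "\<lambda>n. a z n - a (- z) n"] odd
    by (simp add: strict_mono_def even)
  moreover have "summable (\<lambda>n. a z (2 * n))"
    using assms unfolding vertex_series_converge_def a_def by simp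
  ultimately have "suminf (a z) - suminf (a (- z)) = 2 * (\<Sum>n. a z (2 * n))"
    by (metis sums_unique suminf_mult)
  moreover have "KP_vertex K w f t = suminf (a w)" for w
    unfolding KP_vertex_def a_def ..
  moreover have "BKP_vertex K z f t = 2 * (\<Sum>n. a z (2 * n))"
    by (simp add: BKP_vertex_def a_def)
  ultimately show ?thesis
    by simp
qed

theorem mainTheorem1:
  fixes K :: "complex set"
    and T :: "(nat \<Rightarrow> complex) set"
    and St :: "complex \<Rightarrow> (nat \<Rightarrow> complex) \<Rightarrow> complex"
  assumes "K = \<real> \<or> K = UNIV"
    and "time_domain K T"
    and "dKP_solution K T St"
    and "\<forall>t \<in> T \<inter> zero_even_times. \<forall>z. S_fun St (- z) t = - S_fun St z t"
  shows "\<forall>t \<in> T \<inter> zero_even_times. \<forall>z z1.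
           norm z1 > 1 \<and> p_fun K St z1 t + p_fun K St z t \<noteq> 0 \<longrightarrow>
           (p_fun K St z1 t - p_fun K St z t) / (p_fun K St z1 t + p_fun K St z t)
             = exp_neg_BKP_vertex K St z1 z t"
proof (intro ballI allI impI, elim conjE)
  fix t z z1
  assume t: "t \<in> T \<inter> zero_even_times" and z1: "norm (z1::complex) > 1"
  have adm: "admissible_St K T St"
    using assms(3) unfolding dKP_solution_def by blast
  \<comment> \<open>The point \<open>w\<close> is kept general because both \<open>z1\<close> and
    \<open>- z1\<close> are inserted later, with the same \<open>z\<close>.\<close>
  have KP: "p_fun K St w t - p_fun K St z t = (w - z) * exp (- KP_vertex K w (St z) t)"
    if "norm w > 1" for w
  proof -
    have "p_fun K St z t - p_fun K St w t + w * exp_neg_KP_vertex K St w z t = 0"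
      using assms(3) t that unfolding dKP_solution_def by blast
    moreover have "w * (1 - z / w) = w - z"
      using that by (auto simp: field_simps)
    ultimately show ?thesis
      unfolding exp_neg_KP_vertex_def by algebra
  qed
  have smooth: "smooth_in_times K T (S_fun St z1)" and conv: "vertex_series_converge K T (St z)"
    using adm unfolding admissible_St_def by blast+
  \<comment> \<open>At \<open>- z1\<close> oddness turns the left side into -(p(z1) + p(z)), and the
    linear factor is -(z1 + z); the two signs cancel.\<close>
  have sum: "p_fun K St z1 t + p_fun K St z t = (z1 + z) * exp (- KP_vertex K (- z1) (St z) t)"
    using KP[of "- z1"] z1 p_fun_odd[OF assms(1,2) smooth assms(4) t]
    by (simp add: algebra_simps)
  have "exp (- BKP_vertex K z1 (St z) t)
      = exp (- KP_vertex K z1 (St z) t) / exp (- KP_vertex K (- z1) (St z) t)"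
    using KP_vertex_diff_eq_BKP_vertex[OF conv IntD1[OF t] z1, symmetric] by (simp flip: exp_diff)
  \<comment> \<open>Both equations now give a linear factor times an exponential, and the quotient
    is taken factor by factor.\<close>
  then show "(p_fun K St z1 t - p_fun K St z t) / (p_fun K St z1 t + p_fun K St z t)
      = exp_neg_BKP_vertex K St z1 z t"
    unfolding KP[OF z1] sum exp_neg_BKP_vertex_def by simp
qed

end
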